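(* Let $n\ge 1$, let $\boldsymbol{\Sigma}=(\sigma_{ij})\in\mathbb{R}^{n\times n}$ be a covariance matrix (symmetric positive semidefinite), with $\sigma_i\ge 0$ and $\sigma_i^2=\sigma_{ii}$ for $i=1,\dots,n$, let $\boldsymbol{\mu}\in\mathbb{R}^n$, let $d\in\mathbb{R}$, and let $\Omega\ge 0$. Suppose that $\mu_i\ge\Omega\,\sigma_i$ for all $i=1,\dots,n$. Then the set function $q:\{0,1\}^n\to\mathbb{R}$ defined by $$q(\mathbf{x})=\Omega^2\,\mathbf{x}'\boldsymbol{\Sigma}\mathbf{x}-(\boldsymbol{\mu}'\mathbf{x}-d)^2$$ is submodular.
   Context: A prime denotes transpose. Functions on $\{0,1\}^n$ are identified with set functions on $N=\{1,\dots,n\}$ via characteristic vectors: $\mathbf{x}\in\{0,1\}^n$ corresponds to $\{i : x_i=1\}$. A set function $g:2^N\to\mathbb{R}$ is supermodular if, for every $i\in N$ and all $S\subseteq T\subseteq N\setminus\{i\}$, $g(S\cup\{i\})-g(S)\le g(T\cup\{i\})-g(T)$; it is submodular if $-g$ is supermodular. *)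

theory Defs
  imports "HOL-Analysis.Analysis"
begin

text \<open>Set functions are considered on the subsets of a ground set \<open>N\<close>; their values on
  other sets are irrelevant.\<close>

definition supermodular_on :: "'a set \<Rightarrow> ('a set \<Rightarrow> real) \<Rightarrow> bool" where
  "supermodular_on N g \<longleftrightarrow>
    (\<forall>i\<in>N. \<forall>S T. S \<subseteq> T \<and> T \<subseteq> N - {i} \<longrightarrow>
      g (S \<union> {i}) - g S \<le> g (T \<union> {i}) - g T)"

definition submodular_on :: "'a set \<Rightarrow> ('a set \<Rightarrow> real) \<Rightarrow> bool" where
  "submodular_on N g \<longleftrightarrow> supermodular_on N (\<lambda>S. - g S)"

definition char_vec :: "'n set \<Rightarrow> real ^ 'n::finite" where
  "char_vec S = (\<chi> i. if i \<in> S then 1 else 0)"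

text \<open>\<open>char_vec\<close> is a bijection between the subsets of the index type and the 0/1-vectors,
  so the set function below depends only on the restriction of \<open>f\<close> to 0/1-vectors.\<close>

definition set_function :: "(real ^ 'n::finite \<Rightarrow> real) \<Rightarrow> 'n set \<Rightarrow> real" where
  "set_function f S = f (char_vec S)"

definition covariance_matrix :: "real ^ 'n ^ 'n::finite \<Rightarrow> bool" where
  "covariance_matrix A \<longleftrightarrow> transpose A = A \<and> (\<forall>x. 0 \<le> x \<bullet> (A *v x))"

end

theory Submission
  imports Defs
begin

text \<open>
  The second difference of \<open>q\<close> at coordinates \<open>i \<noteq> j\<close> is
  \<open>2 * (\<Omega>\<^sup>2 * \<Sigma> $ i $ j - \<mu> $ i * \<mu> $ j)\<close>. It is nonpositive because positive semidefiniteness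
  gives \<open>\<Sigma> $ i $ j \<le> \<sigma> $ i * \<sigma> $ j\<close>, and \<open>(\<Omega> * \<sigma> $ i) * (\<Omega> * \<sigma> $ j) \<le> \<mu> $ i * \<mu> $ j\<close>.
\<close>

text \<open>For \<open>c > 0\<close> a single point suffices: with \<open>s = c\<close> fixed, the
  form is least at \<open>t = - b\<close>, where it equals
  \<open>c * (a * c - b\<^sup>2)\<close>.\<close>

lemma nonneg_quadratic_form_discriminant:
  fixes a b c :: real
  assumes nonneg: "\<And>s t. 0 \<le> s\<^sup>2 * a + 2 * s * t * b + t\<^sup>2 * c"
  shows "b\<^sup>2 \<le> a * c"
proof (cases "c = 0")
  case True
  have a: "0 \<le> a" using nonneg[of 1 0] by simp
  \<comment> \<open>With \<open>c = 0\<close> the form is linear in \<open>t\<close>; this choice of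
    \<open>t\<close> makes its value negative unless \<open>b = 0\<close>.\<close>
  have "0 \<le> b\<^sup>2 * a + 2 * b * (- (a + 1)) * b" using nonneg[of b "- (a + 1)"] True by simp
  also have "\<dots> = - (b\<^sup>2 * (a + 2))" by (simp add: power2_eq_square algebra_simps)
  finally have "b\<^sup>2 * (a + 2) \<le> 0" by simp
  then have "b\<^sup>2 \<le> 0" using a by (simp add: mult_le_0_iff)
  then show ?thesis using True by simp
next
  case False
  then have c: "0 < c" using nonneg[of 0 1] by simp
  have "0 \<le> c\<^sup>2 * a + 2 * c * (- b) * b + (- b)\<^sup>2 * c" by (rule nonneg)
  also have "\<dots> = c * (a * c - b\<^sup>2)" by (simp add: power2_eq_square algebra_simps)
  finally show ?thesis using c by (simp add: zero_le_mult_iff)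
qed

lemma symmetric_matrix_inner_commute:
  fixes A :: "real ^ 'n ^ 'n::finite"
  assumes "transpose A = A"
  shows "x \<bullet> (A *v y) = y \<bullet> (A *v x)"
  by (metis assms dot_lmul_matrix inner_commute transpose_matrix_vector)

lemma inner_axis_matrix_vector_axis:
  fixes A :: "real ^ 'n ^ 'n::finite"
  shows "axis i 1 \<bullet> (A *v axis j 1) = A $ i $ j"
  by (simp add: inner_axis' matrix_vector_mult_basis column_def)

text \<open>Cauchy-Schwarz for the semidefinite form of \<open>A\<close>, obtained by restricting it
  to combinations of the axis vectors at \<open>i\<close> and \<open>j\<close>.\<close>

lemma covariance_entry_le:
  fixes A :: "real ^ 'n ^ 'n::finite"
  assumes cov: "covariance_matrix A"
    and "0 \<le> s" "s\<^sup>2 = A $ i $ i" "0 \<le> t" "t\<^sup>2 = A $ j $ j"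
  shows "A $ i $ j \<le> s * t"
proof -
  have sym: "transpose A = A" using cov by (simp add: covariance_matrix_def)
  have "0 \<le> u\<^sup>2 * (A $ i $ i) + 2 * u * v * (A $ i $ j) + v\<^sup>2 * (A $ j $ j)" for u v
  proof -
    let ?x = "u *\<^sub>R axis i 1 + v *\<^sub>R axis j 1 :: real ^ 'n"
    have "A $ j $ i = A $ i $ j"
      using sym by (metis transpose_def vec_lambda_beta)
    then have "?x \<bullet> (A *v ?x) = u\<^sup>2 * (A $ i $ i) + 2 * u * v * (A $ i $ j) + v\<^sup>2 * (A $ j $ j)"
      by (simp add: matrix_vector_right_distrib matrix_vector_mult_scaleR inner_add_left
          inner_add_right inner_axis_matrix_vector_axis power2_eq_square algebra_simps)
    moreover have "0 \<le> ?x \<bullet> (A *v ?x)" using cov by (simp only: covariance_matrix_def)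
    ultimately show ?thesis by simp
  qed
  then have "(A $ i $ j)\<^sup>2 \<le> (A $ i $ i) * (A $ j $ j)"
    by (rule nonneg_quadratic_form_discriminant)
  also have "\<dots> = (s * t)\<^sup>2" using assms by (simp add: power_mult_distrib)
  finally show ?thesis by (rule power2_le_imp_le) (use assms in simp)
qed

lemma char_vec_insert:
  "i \<notin> S \<Longrightarrow> char_vec (S \<union> {i}) = char_vec S + axis i 1"
  by (auto simp: char_vec_def axis_def vec_eq_iff)

lemma char_vec_diff:
  "S \<subseteq> T \<Longrightarrow> char_vec T = char_vec S + char_vec (T - S)"
  by (auto simp: char_vec_def vec_eq_iff)

theorem proposition2:
  fixes \<Sigma> :: "real ^ 'n ^ 'n::finite"
    and \<sigma> \<mu> :: "real ^ 'n"
    and d \<Omega> :: real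
  assumes "covariance_matrix \<Sigma>"
    and "\<And>i. 0 \<le> \<sigma> $ i"
    and "\<And>i. (\<sigma> $ i)\<^sup>2 = \<Sigma> $ i $ i"
    and "0 \<le> \<Omega>"
    and "\<And>i. \<Omega> * \<sigma> $ i \<le> \<mu> $ i"
  shows "submodular_on UNIV
    (set_function (\<lambda>x. \<Omega>\<^sup>2 * (x \<bullet> (\<Sigma> *v x)) - (\<mu> \<bullet> x - d)\<^sup>2))"
  (is "submodular_on UNIV (set_function ?q)")
proof -
  note inner_\<Sigma>_commute =
    symmetric_matrix_inner_commute[OF assms(1)[unfolded covariance_matrix_def, THEN conjunct1]]
  have entry: "\<Omega>\<^sup>2 * \<Sigma> $ i $ j \<le> \<mu> $ i * \<mu> $ j" for i j
  proof -
    have "\<Omega>\<^sup>2 * \<Sigma> $ i $ j \<le> \<Omega>\<^sup>2 * (\<sigma> $ i * \<sigma> $ j)"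
      by (intro mult_left_mono covariance_entry_le assms) simp
    also have "\<dots> = (\<Omega> * \<sigma> $ i) * (\<Omega> * \<sigma> $ j)"
      by (simp add: power2_eq_square)
    also have "\<dots> \<le> \<mu> $ i * \<mu> $ j"
      \<comment> \<open>Multiplying the two bounds requires \<open>\<Omega> * \<sigma> $ i\<close>
        and \<open>\<Omega> * \<sigma> $ j\<close> to be nonnegative.\<close>
      by (rule mult_mono') (simp_all add: assms)
    finally show ?thesis .
  qed
  \<comment> \<open>The increments are stated for vectors; \<open>char_vec_insert\<close> turns
    \<open>char_vec T + axis i 1\<close> into the vector of \<open>T \<union> {i}\<close> at the
    end, where \<open>i\<close> lies outside \<open>T\<close>.\<close>
  have "?q (char_vec T + axis i 1) - ?q (char_vec T) \<le> ?q (char_vec S + axis i 1) - ?q (char_vec S)"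
    if "S \<subseteq> T" for S T i
  proof -
    define x where "x = char_vec S"
    \<comment> \<open>All of \<open>T - S\<close> is added at once, with no induction over its
      elements: the entries of \<open>z\<close> are nonnegative, so the entrywise bounds can be
      weighted by them and summed.\<close>
    define z where "z = char_vec (T - S)"
    define e :: "real ^ 'n" where "e = axis i 1"
    have "\<Omega>\<^sup>2 * (e \<bullet> (\<Sigma> *v z)) = (\<Sum>j\<in>UNIV. (\<Omega>\<^sup>2 * \<Sigma> $ i $ j) * z $ j)"
      by (simp add: e_def inner_axis' matrix_vector_mult_def sum_distrib_left mult.assoc)
    also have "\<dots> \<le> (\<Sum>j\<in>UNIV. (\<mu> $ i * \<mu> $ j) * z $ j)"
      by (intro sum_mono mult_right_mono entry) (simp add: z_def char_vec_def)
    also have "\<dots> = (\<mu> \<bullet> e) * (\<mu> \<bullet> z)"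
      by (simp add: e_def inner_axis inner_vec_def[of \<mu> z] sum_distrib_left mult.assoc)
    finally have cross: "\<Omega>\<^sup>2 * (e \<bullet> (\<Sigma> *v z)) \<le> (\<mu> \<bullet> e) * (\<mu> \<bullet> z)" .
    \<comment> \<open>For a quadratic function the mixed difference in directions \<open>e\<close>
      and \<open>z\<close> is bilinear in them, so \<open>x\<close> and \<open>d\<close> cancel;
      symmetry of \<open>\<Sigma>\<close> merges the two cross terms.\<close>
    have "(?q (x + z + e) - ?q (x + z)) - (?q (x + e) - ?q x)
        = 2 * (\<Omega>\<^sup>2 * (e \<bullet> (\<Sigma> *v z)) - (\<mu> \<bullet> e) * (\<mu> \<bullet> z))"
      by (simp add: matrix_vector_right_distrib inner_add_left inner_add_right
          inner_\<Sigma>_commute[of x e] inner_\<Sigma>_commute[of z e] power2_eq_square algebra_simps)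
    also have "\<dots> \<le> 0" using cross by simp
    finally have "?q (x + z + e) - ?q (x + z) \<le> ?q (x + e) - ?q x"
      by (simp only: diff_le_0_iff_le)
    then show ?thesis
      by (simp only: char_vec_diff[OF that] x_def z_def e_def)
  qed
  then show ?thesis
    unfolding submodular_on_def supermodular_on_def set_function_def
    by (smt (verit) Diff_iff char_vec_insert singletonI subsetD)
qed

end
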